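(* The set function $\mathcal{K}\mapsto J_{\mathcal{K}}:=\mathbf{b}^{\mathsf T}\big(L_\beta+\mathrm{diag}(\boldsymbol{\alpha}_{\mathcal{K}})\big)^{-1}\mathbf{c}$, $\mathcal{K}\subseteq\mathcal{V}$, is supermodular and nonincreasing in $\mathcal{K}$.
   Context: Setting: $\mathcal{G}=(\mathcal{V},\mathcal{E})$ is a strongly connected directed graph on $\mathcal{V}=\{1,\dots,N\}$; $W=[w_{ij}]\in\mathbb{R}^{N\times N}$ is a nonnegative matrix such that for $i\ne j$, $w_{ij}>0$ if $(i,j)\in\mathcal{E}$ and $w_{ij}=0$ otherwise, and $w_{ii}>0$ for some $i$. $L:=\mathrm{diag}(W\mathbf{1})-W$, and $L_\beta:=L+\mathrm{diag}(\boldsymbol{\beta})$ with $\boldsymbol{\beta}\in\mathbb{R}^N_+$ (possibly $\mathbf{0}$). The vectors $\mathbf{b},\mathbf{c}\in\mathbb{R}^N_+$ are nonzero, $\boldsymbol{\alpha}\in\mathbb{R}^N_+$, and $\boldsymbol{\alpha}_{\mathcal{K}}$ is the vector with $i$-th entry $\alpha_i$ if $i\in\mathcal{K}$ and $0$ otherwise. $\mathrm{diag}(\mathbf{x})$ is the diagonal matrix with diagonal $\mathbf{x}$, and $\mathbf{1}$ is the all-ones vector. A set function $F$ on subsets of $\mathcal{V}$ is supermodular if $F(\mathcal{S})-F(\mathcal{S}\cup\{v\})\ge F(\mathcal{T})-F(\mathcal{T}\cup\{v\})$ for all $\mathcal{S}\subseteq\mathcal{T}\subseteq\mathcal{V}$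 and $v\in\mathcal{V}\setminus\mathcal{T}$; it is nonincreasing if $\mathcal{S}\subseteq\mathcal{T}$ implies $F(\mathcal{S})\ge F(\mathcal{T})$. Convention: if $L_\beta+\mathrm{diag}(\boldsymbol{\alpha}_{\mathcal{K}})$ is singular (i.e. $\boldsymbol{\beta}=\mathbf{0}$ and $\boldsymbol{\alpha}_{\mathcal{K}}=\mathbf{0}$) then $J_{\mathcal{K}}=+\infty$, and where infinite values occur the supermodularity inequality is read in the rearranged form $F(\mathcal{S})+F(\mathcal{T}\cup\{v\})\ge F(\mathcal{T})+F(\mathcal{S}\cup\{v\})$. *)

theory Defs
  imports "HOL-Analysis.Analysis" "Graph_Theory.Digraph_Component"
begin

definition diag_matrix :: "real^'n \<Rightarrow> real^'n^'n" where
  "diag_matrix x = (\<chi> i j. if i = j then x $ i else 0)"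

text \<open>In the next definition, \<open>1 :: real^'n\<close> is the all-ones vector.\<close>

definition laplacian :: "real^'n^'n \<Rightarrow> real^'n^'n" where
  "laplacian W = diag_matrix (W *v 1) - W"

definition perturbed_laplacian :: "real^'n^'n \<Rightarrow> real^'n \<Rightarrow> real^'n^'n" where
  "perturbed_laplacian W \<beta> = laplacian W + diag_matrix \<beta>"

definition restrict_vec :: "real^'n \<Rightarrow> 'n set \<Rightarrow> real^'n" where
  "restrict_vec \<alpha> K = (\<chi> i. if i \<in> K then \<alpha> $ i else 0)"

text \<open>
  The explicit case split is needed because \<open>matrix_inv\<close> of a singular matrix is an arbitrary value.
\<close>

definition J_cost ::
  "real^'n^'n \<Rightarrow> real^'n \<Rightarrow> real^'n \<Rightarrow> real^'n \<Rightarrow> real^'n \<Rightarrow> 'n set \<Rightarrow> ereal" where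
  "J_cost W \<beta> \<alpha> b c K =
    (let M = perturbed_laplacian W \<beta> + diag_matrix (restrict_vec \<alpha> K)
     in if invertible M then ereal (b \<bullet> (matrix_inv M *v c)) else \<infinity>)"

text \<open>
  The ground set is the whole (finite) type. As soon as one of the four values is infinite, the
  difference inequality is replaced by its rearranged form, since differences such as
  \<open>\<infinity> - \<infinity>\<close> have a meaningless value in \<^typ>\<open>ereal\<close>.
\<close>

definition supermodular :: "('n::finite set \<Rightarrow> ereal) \<Rightarrow> bool" where
  "supermodular F \<longleftrightarrow>
    (\<forall>S T v. S \<subseteq> T \<and> v \<notin> T \<longrightarrow>
      (if \<forall>X \<in> {S, T, S \<union> {v}, T \<union> {v}}. \<bar>F X\<bar> \<noteq> \<infinity>
       then F S - F (S \<union> {v}) \<ge> F T - F (T \<union> {v})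
       else F S + F (T \<union> {v}) \<ge> F T + F (S \<union> {v})))"

end

theory Submission
  imports Defs
begin

text \<open>
  Put \<open>A = L + diag \<delta>\<close> with \<open>\<delta> \<ge> 0\<close>. Strong connectivity gives a minimum principle: if
  \<open>\<delta> \<noteq> 0\<close> and \<open>A x \<ge> 0\<close> then \<open>x \<ge> 0\<close>. Hence \<open>A\<close> is invertible with an entrywise nonnegative
  inverse, whereas \<open>\<delta> = 0\<close> makes \<open>A\<close> annihilate the all-ones vector. The resolvent identity
  \<open>A\<inverse> - B\<inverse> = A\<inverse> (B - A) B\<inverse>\<close> then shows first that the inverse is antitone in \<open>\<delta>\<close>, and
  second, because \<open>\<delta>\<close> grows by the same amount when \<open>v\<close> is added to \<open>S\<close> or to \<open>T\<close>, that the
  decrease of the inverse is itself antitone, which is supermodularity.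
\<close>

section \<open>Entrywise order on matrices and the resolvent identity\<close>

lemma matrix_matrix_mult_mono:
  fixes A A' :: "real^'m::finite^'n::finite" and B B' :: "real^'k::finite^'m"
  assumes "0 \<le> A" "A \<le> A'" "0 \<le> B" "B \<le> B'"
  shows "A ** B \<le> A' ** B'"
proof -
  have "A $ i $ k \<le> A' $ i $ k" "0 \<le> A' $ i $ k" "0 \<le> B $ k $ j" "B $ k $ j \<le> B' $ k $ j" for i j k
    using assms order_trans[OF assms(1,2)] by (simp_all add: less_eq_vec_def)
  then show ?thesis
    unfolding less_eq_vec_def matrix_matrix_mult_def
    by (auto intro!: sum_mono mult_mono)
qed

lemma inner_matrix_vector_mult_mono:
  fixes A B :: "real^'n::finite^'m::finite"
  assumes "A \<le> B" "\<And>i. 0 \<le> b $ i" "\<And>i. 0 \<le> c $ i"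
  shows "b \<bullet> (A *v c) \<le> b \<bullet> (B *v c)"
  using assms
  by (auto simp: inner_vec_def matrix_vector_mult_def less_eq_vec_def
      intro!: sum_mono mult_left_mono mult_right_mono)

lemma matrix_diff_ldistrib:
  fixes A :: "'a::ring_1^'m::finite^'n"
  shows "A ** (B - C) = A ** B - A ** C"
  by (simp add: matrix_matrix_mult_def vec_eq_iff right_diff_distrib sum_subtractf)

lemma matrix_diff_rdistrib:
  fixes A B :: "'a::ring_1^'m::finite^'n"
  shows "(A - B) ** C = A ** C - B ** C"
  by (simp add: matrix_matrix_mult_def vec_eq_iff left_diff_distrib sum_subtractf)

lemma
  assumes "invertible A"
  shows matrix_mult_inv_right: "A ** matrix_inv A = mat 1"
    and matrix_mult_inv_left: "matrix_inv A ** A = mat 1"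
  using someI_ex[of "\<lambda>B. A ** B = mat 1 \<and> B ** A = mat 1"] assms
  by (auto simp: invertible_def matrix_inv_def)

lemma matrix_inv_diff:
  fixes A B :: "real^'n::finite^'n"
  assumes "invertible A" "invertible B"
  shows "matrix_inv A - matrix_inv B = matrix_inv A ** (B - A) ** matrix_inv B"
proof -
  have "matrix_inv A ** (B - A) ** matrix_inv B
      = matrix_inv A ** (B ** matrix_inv B) - (matrix_inv A ** A) ** matrix_inv B"
    by (simp add: matrix_diff_ldistrib matrix_diff_rdistrib matrix_mul_assoc)
  then show ?thesis
    using assms by (simp add: matrix_mult_inv_left matrix_mult_inv_right)
qed

text \<open>If \<open>A *v x = 0\<close>, then \<open>min\<close> applies to both \<open>x\<close>
  and \<open>- x\<close>, so the kernel is trivial. Column \<open>j\<close> of the inverse is sent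
  by \<open>A\<close> to the unit vector \<open>axis j 1\<close>, which is nonnegative, so
  \<open>min\<close> makes the column nonnegative too.\<close>

lemma invertible_if_minimum_principle:
  fixes A :: "real^'n::finite^'n"
  assumes min: "\<And>x. 0 \<le> A *v x \<Longrightarrow> 0 \<le> x"
  shows "invertible A" and "0 \<le> matrix_inv A"
proof -
  have "x = 0" if "A *v x = 0" for x
  proof -
    have "0 \<le> x" "0 \<le> - x"
      by (rule min, simp add: that linear_neg[OF matrix_vector_mul_linear])+
    then show ?thesis
      by (simp add: less_eq_vec_def vec_eq_iff order_antisym)
  qed
  then show inv: "invertible A"
    by (simp add: invertible_left_inverse matrix_left_invertible_ker)
  have "0 \<le> matrix_inv A *v axis j 1" for j
    by (rule min)
      (simp add: inv matrix_vector_mul_assoc matrix_mult_inv_right less_eq_vec_def axis_def)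
  then show "0 \<le> matrix_inv A"
    by (simp add: less_eq_vec_def matrix_vector_mul_component inner_axis)
qed

section \<open>Laplacians and irreducibility\<close>

lemma diag_matrix_add: "diag_matrix (x + y) = diag_matrix x + diag_matrix y"
  by (simp add: diag_matrix_def vec_eq_iff)

lemma diag_matrix_nonneg: "0 \<le> x \<Longrightarrow> 0 \<le> diag_matrix x"
  by (simp add: diag_matrix_def less_eq_vec_def)

lemma diag_matrix_mult_vec: "(diag_matrix d *v x) $ i = d $ i * x $ i"
proof -
  have "(diag_matrix d *v x) $ i = (\<Sum>j\<in>UNIV. if i = j then d $ i * x $ j else 0)"
    unfolding diag_matrix_def matrix_vector_mult_def vec_lambda_beta by (rule sum.cong) auto
  then show ?thesis
    by simp
qed

text \<open>Written with differences, the row has a visible sign wherever \<open>x\<close> is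
  minimal, and it plainly vanishes on constant vectors.\<close>

lemma laplacian_mult_vec:
  "(laplacian W *v x) $ i = (\<Sum>j\<in>UNIV. W $ i $ j * (x $ i - x $ j))"
proof -
  have "(laplacian W *v x) $ i = (W *v 1) $ i * x $ i - (W *v x) $ i"
    by (simp add: laplacian_def matrix_vector_mult_diff_rdistrib diag_matrix_mult_vec)
  then show ?thesis
    by (simp add: matrix_vector_mult_def right_diff_distrib sum_subtractf sum_distrib_right)
qed

text \<open>Irreducibility is stated through cuts instead of paths because it will be applied to one
  particular set, the minimizers of a vector.\<close>

definition irreducible_matrix :: "real^'n::finite^'n \<Rightarrow> bool" where
  "irreducible_matrix W \<longleftrightarrow>
    (\<forall>I. I \<noteq> {} \<and> I \<noteq> UNIV \<longrightarrow> (\<exists>i\<in>I. \<exists>j. j \<notin> I \<and> 0 < W $ i $ j))"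

text \<open>A path from a vertex of \<open>I\<close> to a vertex outside must leave \<open>I\<close>
  along some edge, and that edge carries positive weight.\<close>

lemma irreducible_matrix_if_strongly_connected:
  fixes G :: "'n::finite pair_pre_digraph"
  assumes verts: "pverts G = UNIV"
    and strong: "strongly_connected (with_proj G)"
    and W_edge: "\<And>i j. i \<noteq> j \<Longrightarrow> (i, j) \<in> parcs G \<Longrightarrow> W $ i $ j > 0"
  shows "irreducible_matrix W"
  unfolding irreducible_matrix_def
proof (intro allI impI)
  fix I :: "'n set"
  assume "I \<noteq> {} \<and> I \<noteq> UNIV"
  then obtain u v where u: "u \<in> I" and v: "v \<notin> I"
    by blast
  have "(u, v) \<in> rtrancl_on UNIV (parcs G)"
    using strong verts
    by (auto simp: strongly_connected_def reachable_def arcs_ends_def arc_to_ends_def)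
  \<comment> \<open>Invariant along the path: either it is still in \<open>I\<close>, or a crossing
    edge has already been met.\<close>
  then have "v \<in> I \<or> (\<exists>i\<in>I. \<exists>j. j \<notin> I \<and> (i, j) \<in> parcs G)"
    by (induction rule: rtrancl_on_induct) (use u in auto)
  then show "\<exists>i\<in>I. \<exists>j. j \<notin> I \<and> 0 < W $ i $ j"
    using v W_edge by metis
qed

section \<open>The minimum principle and invertibility\<close>

locale irreducible_weights =
  fixes W :: "real^'n::finite^'n"
  assumes weight_nonneg: "0 \<le> W $ i $ j"
    and irreducible: "irreducible_matrix W"
begin

text \<open>Discrete minimum principle: a negative minimum spreads along positive weights to all
  vertices, so \<open>x\<close> is constant, and then no entry of \<delta> can be positive.\<close>

lemma minimum_principle:
  assumes \<delta>: "0 \<le> \<delta>" "\<delta> \<noteq> 0" and x: "0 \<le> (laplacian W + diag_matrix \<delta>) *v x"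
  shows "0 \<le> x"
proof (rule ccontr)
  assume "\<not> 0 \<le> x"
  then obtain k where "x $ k < 0"
    by (auto simp: less_eq_vec_def not_le)
  define m where "m = Min (range (($) x))"
  have m_le: "m \<le> x $ i" for i
    by (simp add: m_def)
  with \<open>x $ k < 0\<close> have "m < 0"
    by (rule le_less_trans[rotated])
  have \<delta>_nonneg: "0 \<le> \<delta> $ i" for i
    using \<delta>(1) by (simp add: less_eq_vec_def)
  \<comment> \<open>At a minimizer, row \<open>i\<close> of the hypothesis says that a sum of two
    nonpositive terms is nonnegative. Both terms are therefore zero, and so is every summand of the
    first.\<close>
  have at_min: "\<delta> $ i = 0 \<and> (\<forall>j. W $ i $ j * (x $ j - m) = 0)" if "x $ i = m" for i
  proof -
    have "0 \<le> (\<Sum>j\<in>UNIV. W $ i $ j * (m - x $ j)) + \<delta> $ i * m"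
      using x that
      by (simp add: less_eq_vec_def matrix_vector_mult_add_rdistrib laplacian_mult_vec
          diag_matrix_mult_vec flip: that)
    moreover have "(\<Sum>j\<in>UNIV. W $ i $ j * (m - x $ j)) = - (\<Sum>j\<in>UNIV. W $ i $ j * (x $ j - m))"
      by (simp add: algebra_simps flip: sum_negf)
    moreover have "0 \<le> (\<Sum>j\<in>UNIV. W $ i $ j * (x $ j - m))"
      using m_le weight_nonneg by (intro sum_nonneg) simp
    moreover have "\<delta> $ i * m \<le> 0"
      using \<delta>_nonneg \<open>m < 0\<close> by (simp add: mult_nonneg_nonpos)
    ultimately have "(\<Sum>j\<in>UNIV. W $ i $ j * (x $ j - m)) = 0" "\<delta> $ i * m = 0"
      by linarith+
    then show ?thesis
      using m_le weight_nonneg \<open>m < 0\<close> by (simp add: sum_nonneg_eq_0_iff)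
  qed
  have "m \<in> range (($) x)"
    unfolding m_def by (rule Min_in) auto
  then have "{i. x $ i = m} \<noteq> {}"
    by auto
  moreover have "\<not> 0 < W $ i $ j" if "x $ i = m" "x $ j \<noteq> m" for i j
  proof -
    have "W $ i $ j * (x $ j - m) = 0"
      using at_min[OF that(1)] by blast
    with that(2) show ?thesis
      by simp
  qed
  \<comment> \<open>No positive weight leaves the nonempty set of minimizers, so irreducibility
    forces it to be everything.\<close>
  ultimately have "{i. x $ i = m} = UNIV"
    using irreducible[unfolded irreducible_matrix_def, rule_format, of "{i. x $ i = m}"] by auto
  then have "\<delta> = 0"
    using at_min by (auto simp: vec_eq_iff)
  with \<delta>(2) show False ..
qed

lemma matrix_inv_nonneg:
  assumes "0 \<le> \<delta>" "\<delta> \<noteq> 0"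
  shows "0 \<le> matrix_inv (laplacian W + diag_matrix \<delta>)"
  using minimum_principle[OF assms] by (rule invertible_if_minimum_principle)

lemma invertible_iff:
  assumes "0 \<le> \<delta>"
  shows "invertible (laplacian W + diag_matrix \<delta>) \<longleftrightarrow> \<delta> \<noteq> 0"
proof
  assume "invertible (laplacian W + diag_matrix \<delta>)"
  then have ker: "x = 0" if "(laplacian W + diag_matrix \<delta>) *v x = 0" for x
    using that by (simp add: invertible_left_inverse matrix_left_invertible_ker)
  show "\<delta> \<noteq> 0"
  proof
    assume "\<delta> = 0"
    then have "(laplacian W + diag_matrix \<delta>) *v 1 = 0"
      by (simp add: vec_eq_iff matrix_vector_mult_add_rdistrib laplacian_mult_vec
          diag_matrix_mult_vec)
    then have "(1 :: real^'n) = 0"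
      by (rule ker)
    then show False
      by simp
  qed
next
  assume "\<delta> \<noteq> 0"
  with assms show "invertible (laplacian W + diag_matrix \<delta>)"
    by (rule invertible_if_minimum_principle(1)[OF minimum_principle])
qed

text \<open>In the resolvent identity the middle factor is the increment alone, so it does not
  change when \<delta> is replaced by a larger vector.\<close>

lemma matrix_inv_diff_add:
  assumes "0 \<le> \<delta>" "\<delta> \<noteq> 0" "0 \<le> \<epsilon>"
  shows "matrix_inv (laplacian W + diag_matrix \<delta>) - matrix_inv (laplacian W + diag_matrix (\<delta> + \<epsilon>))
    = matrix_inv (laplacian W + diag_matrix \<delta>) ** diag_matrix \<epsilon>
      ** matrix_inv (laplacian W + diag_matrix (\<delta> + \<epsilon>))"
proof -
  have "0 \<le> \<delta> + \<epsilon>" "\<delta> + \<epsilon> \<noteq> 0"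
    using assms by (auto simp: less_eq_vec_def vec_eq_iff add_nonneg_eq_0_iff)
  then have "invertible (laplacian W + diag_matrix \<delta>)"
    "invertible (laplacian W + diag_matrix (\<delta> + \<epsilon>))"
    using assms by (simp_all add: invertible_iff)
  from matrix_inv_diff[OF this] show ?thesis
    by (simp add: diag_matrix_add)
qed

lemma matrix_inv_antimono:
  assumes "0 \<le> \<delta>" "\<delta> \<noteq> 0" "\<delta> \<le> \<delta>'"
  shows "matrix_inv (laplacian W + diag_matrix \<delta>') \<le> matrix_inv (laplacian W + diag_matrix \<delta>)"
proof -
  let ?R = "\<lambda>d. matrix_inv (laplacian W + diag_matrix d)"
  define \<epsilon> where "\<epsilon> = \<delta>' - \<delta>"
  then have \<delta>': "\<delta>' = \<delta> + \<epsilon>" and \<epsilon>: "0 \<le> \<epsilon>"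
    using assms(3) by (simp_all add: less_eq_vec_def)
  have "0 \<le> \<delta>'" "\<delta>' \<noteq> 0"
    using order_trans[OF assms(1,3)] assms order_antisym by blast+
  then have nonneg: "0 \<le> ?R \<delta>" "0 \<le> ?R \<delta>'" "0 \<le> diag_matrix \<epsilon>"
    using assms \<epsilon> by (simp_all add: matrix_inv_nonneg diag_matrix_nonneg)
  \<comment> \<open>Nonnegativity of a product is its monotonicity compared with
    \<open>0 ** 0\<close>.\<close>
  have "0 \<le> ?R \<delta> ** diag_matrix \<epsilon>"
    using matrix_matrix_mult_mono[of 0 "?R \<delta>" 0 "diag_matrix \<epsilon>"] nonneg by simp
  then have "0 \<le> ?R \<delta> ** diag_matrix \<epsilon> ** ?R \<delta>'"
    using matrix_matrix_mult_mono[of 0 "?R \<delta> ** diag_matrix \<epsilon>" 0 "?R \<delta>'"] nonneg by simp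
  then have "0 \<le> ?R \<delta> - ?R \<delta>'"
    using matrix_inv_diff_add[OF assms(1,2) \<epsilon>] by (simp add: \<delta>')
  then show ?thesis
    by (simp add: less_eq_vec_def)
qed

text \<open>Both decreases factor as inverse, \<open>diag_matrix\<close> \<epsilon>, inverse.
  Passing from \<delta> to \<delta>' lowers the two outer factors and keeps the middle one; all
  factors are nonnegative, so the product goes down.\<close>

lemma matrix_inv_diff_antimono:
  assumes \<delta>: "0 \<le> \<delta>" "\<delta> \<noteq> 0" "\<delta> \<le> \<delta>'" and \<epsilon>: "0 \<le> \<epsilon>"
  shows "matrix_inv (laplacian W + diag_matrix \<delta>') - matrix_inv (laplacian W + diag_matrix (\<delta>' + \<epsilon>))
    \<le> matrix_inv (laplacian W + diag_matrix \<delta>) - matrix_inv (laplacian W + diag_matrix (\<delta> + \<epsilon>))"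
proof -
  let ?R = "\<lambda>d. matrix_inv (laplacian W + diag_matrix d)"
  \<comment> \<open>All four perturbations lie above \<delta>, so this one fact supplies the side
    conditions for each of them.\<close>
  have pos: "0 \<le> d" "d \<noteq> 0" if "\<delta> \<le> d" for d
    using order_trans[OF \<delta>(1) that] \<delta>(1,2) that order_antisym by blast+
  have le: "\<delta> \<le> \<delta> + \<epsilon>" "\<delta> \<le> \<delta>' + \<epsilon>" "\<delta> + \<epsilon> \<le> \<delta>' + \<epsilon>"
    using \<delta>(3) \<epsilon> by (auto simp: less_eq_vec_def add_increasing2)
  note D = diag_matrix_nonneg[OF \<epsilon>]
  have "0 \<le> ?R \<delta>' ** diag_matrix \<epsilon>"
    using matrix_matrix_mult_mono[of 0 "?R \<delta>'" 0 "diag_matrix \<epsilon>"] D pos \<delta>(3)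
    by (simp add: matrix_inv_nonneg)
  moreover have "?R \<delta>' ** diag_matrix \<epsilon> \<le> ?R \<delta> ** diag_matrix \<epsilon>"
    using D pos \<delta> by (intro matrix_matrix_mult_mono matrix_inv_nonneg matrix_inv_antimono) auto
  ultimately have "?R \<delta>' ** diag_matrix \<epsilon> ** ?R (\<delta>' + \<epsilon>) \<le> ?R \<delta> ** diag_matrix \<epsilon> ** ?R (\<delta> + \<epsilon>)"
    \<comment> \<open>The instantiation keeps the left product together as one factor, whose two
      bounds have just been proved.\<close>
    using pos le by (intro matrix_matrix_mult_mono[of "?R \<delta>' ** diag_matrix \<epsilon>"]
        matrix_inv_nonneg matrix_inv_antimono) auto
  then show ?thesis
    using pos(1)[OF \<delta>(3)] pos(2)[OF \<delta>(3)] \<delta> \<epsilon> by (simp add: matrix_inv_diff_add)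
qed

end

section \<open>From the resolvent to the cost function\<close>

theorem theorem4:
  fixes G :: "'n::finite pair_pre_digraph"
    and W :: "real^'n^'n"
    and \<alpha> \<beta> b c :: "real^'n"
  assumes verts: "pverts G = UNIV"
    and strong: "strongly_connected (with_proj G)"
    and W_nonneg: "\<And>i j. W $ i $ j \<ge> 0"
    and W_edge: "\<And>i j. i \<noteq> j \<Longrightarrow> (i, j) \<in> parcs G \<Longrightarrow> W $ i $ j > 0"
    and W_nonedge: "\<And>i j. i \<noteq> j \<Longrightarrow> (i, j) \<notin> parcs G \<Longrightarrow> W $ i $ j = 0"
    and W_diag: "\<exists>i. W $ i $ i > 0"
    and \<beta>_nonneg: "\<And>i. \<beta> $ i \<ge> 0"
    and \<alpha>_nonneg: "\<And>i. \<alpha> $ i \<ge> 0"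
    and b_nonneg: "\<And>i. b $ i \<ge> 0" and b_nz: "b \<noteq> 0"
    and c_nonneg: "\<And>i. c $ i \<ge> 0" and c_nz: "c \<noteq> 0"
  shows "supermodular (J_cost W \<beta> \<alpha> b c) \<and> antimono (J_cost W \<beta> \<alpha> b c)"
proof -
  interpret irreducible_weights W
    using irreducible_matrix_if_strongly_connected[OF verts strong W_edge] W_nonneg
    by unfold_locales
  let ?J = "J_cost W \<beta> \<alpha> b c"
  \<comment> \<open>This vector carries the whole dependence on \<open>K\<close>, and the cost is
    infinite exactly when it is zero.\<close>
  define \<delta> where "\<delta> K = \<beta> + restrict_vec \<alpha> K" for K
  let ?R = "\<lambda>d. matrix_inv (laplacian W + diag_matrix d)"
  have \<delta>_nonneg: "0 \<le> \<delta> K" for K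
    using \<beta>_nonneg \<alpha>_nonneg by (simp add: \<delta>_def restrict_vec_def less_eq_vec_def)
  have \<delta>_mono: "\<delta> S \<le> \<delta> T" if "S \<subseteq> T" for S T
    using that \<alpha>_nonneg by (auto simp: \<delta>_def restrict_vec_def less_eq_vec_def)
  have \<delta>_nz: "\<delta> T \<noteq> 0" if "S \<subseteq> T" "\<delta> S \<noteq> 0" for S T
    using \<delta>_mono[OF that(1)] \<delta>_nonneg[of S] that(2) order_antisym by metis
  have J: "?J K = (if \<delta> K = 0 then \<infinity> else ereal (b \<bullet> (?R (\<delta> K) *v c)))" for K
  proof -
    have "perturbed_laplacian W \<beta> + diag_matrix (restrict_vec \<alpha> K)
        = laplacian W + diag_matrix (\<delta> K)"
      by (simp add: perturbed_laplacian_def \<delta>_def diag_matrix_add)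
    then show ?thesis
      using invertible_iff[OF \<delta>_nonneg[of K]] by (simp add: J_cost_def)
  qed
  have J_finite: "\<bar>?J K\<bar> \<noteq> \<infinity> \<longleftrightarrow> \<delta> K \<noteq> 0" for K
    by (simp add: J)
  have "?J T \<le> ?J S" if "S \<subseteq> T" for S T
  proof (cases "\<delta> S = 0")
    case False
    then have "?R (\<delta> T) \<le> ?R (\<delta> S)"
      using \<delta>_nonneg \<delta>_mono[OF that] by (intro matrix_inv_antimono)
    then show ?thesis
      using False \<delta>_nz[OF that]
      by (auto simp: J intro!: inner_matrix_vector_mult_mono b_nonneg c_nonneg)
  qed (simp add: J)
  then have anti: "antimono ?J"
    by (rule antimonoI)
  have "if \<forall>X \<in> {S, T, S \<union> {v}, T \<union> {v}}. \<bar>?J X\<bar> \<noteq> \<infinity>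
       then ?J S - ?J (S \<union> {v}) \<ge> ?J T - ?J (T \<union> {v})
       else ?J S + ?J (T \<union> {v}) \<ge> ?J T + ?J (S \<union> {v})"
    if "S \<subseteq> T" "v \<notin> T" for S T v
  proof (cases "\<delta> S = 0")
    \<comment> \<open>An infinite value at \<open>S\<close> selects the rearranged inequality, whose
      larger side is then infinite.\<close>
    case True
    then have "\<bar>?J S\<bar> = \<infinity>" "?J S + ?J (T \<union> {v}) = \<infinity>"
      by (auto simp: J)
    then show ?thesis
      by auto
  next
    \<comment> \<open>By monotonicity all four perturbations are nonzero, so all four costs are
      finite and the difference form applies.\<close>
    case False
    then have nz: "\<delta> T \<noteq> 0" "\<delta> (S \<union> {v}) \<noteq> 0" "\<delta> (T \<union> {v}) \<noteq> 0"
      using \<delta>_nz[of S] that(1) by blast+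
    define \<epsilon> where "\<epsilon> = restrict_vec \<alpha> {v}"
    have \<epsilon>: "0 \<le> \<epsilon>"
      using \<alpha>_nonneg by (simp add: \<epsilon>_def restrict_vec_def less_eq_vec_def)
    \<comment> \<open>Since \<open>v\<close> lies in neither \<open>S\<close> nor \<open>T\<close>,
      adding it raises both perturbations by the same \<epsilon>.\<close>
    have ins: "\<delta> (K \<union> {v}) = \<delta> K + \<epsilon>" if "v \<notin> K" for K
      using that by (auto simp: \<delta>_def \<epsilon>_def restrict_vec_def vec_eq_iff)
    have insST: "\<delta> (S \<union> {v}) = \<delta> S + \<epsilon>" "\<delta> (T \<union> {v}) = \<delta> T + \<epsilon>"
      using that by (blast intro: ins)+
    have "b \<bullet> ((?R (\<delta> T) - ?R (\<delta> T + \<epsilon>)) *v c) \<le> b \<bullet> ((?R (\<delta> S) - ?R (\<delta> S + \<epsilon>)) *v c)"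
      using matrix_inv_diff_antimono[OF \<delta>_nonneg False \<delta>_mono[OF that(1)] \<epsilon>] b_nonneg c_nonneg
      by (rule inner_matrix_vector_mult_mono)
    then have "?J T - ?J (T \<union> {v}) \<le> ?J S - ?J (S \<union> {v})"
      using False nz
      by (simp only: J insST) (simp add: matrix_vector_mult_diff_rdistrib inner_diff_right)
    moreover have "\<forall>X \<in> {S, T, S \<union> {v}, T \<union> {v}}. \<bar>?J X\<bar> \<noteq> \<infinity>"
      using False nz by (simp add: J_finite)
    ultimately show ?thesis
      by simp
  qed
  then have "supermodular ?J"
    unfolding supermodular_def by blast
  then show ?thesis
    using anti by (rule conjI)
qed

end
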